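(* Suppose that the carrier signal satisfies $f_{\mathrm{c}}(t)=1$ for all $t$. Let $\eta\in\mathbb{R}$ and $\theta_{\mathrm{in}}^{+},\theta_{\mathrm{in}}^{-}\in\mathbb{R}$. If the reference wave satisfies $$E_{\mathrm{r}}(t) = -\eta\, E_{\mathrm{in}}^{+}(t) + (1+\eta)\, E_{\mathrm{in}}^{-}(t)\quad\text{for all } t,$$ then the steady-state performance index is given by $$J_{\mathrm{ss}}(E_{\mathrm{r}}, f_{\mathrm{c}}, \theta_{\mathrm{in}}^{+}, \theta_{\mathrm{in}}^{-}) = \bigl| I_{1}\, \tilde{A}^{2}\, (2\eta+1)\bigr|\,\bigl(1-\cos(\theta_{\mathrm{in}}^{-}-\theta_{\mathrm{in}}^{+})\bigr).$$
   Context: Constants: $m>0$ (effective mass), $\gamma>0$ (viscosity), $k>0$ (elasticity), $\omega_{\mathrm{in}}>0$ (frequency), and real constants $q$ (charge), $A_{\mathrm{in}}$ (amplitude), $I_1$ (current coefficient). Incoming waves: for phases $\theta_{\mathrm{in}}^{+},\theta_{\mathrm{in}}^{-}\in\mathbb{R}$, put $E_{\mathrm{in}}^{\pm}(t) := A_{\mathrm{in}}\cos(\omega_{\mathrm{in}} t+\theta_{\mathrm{in}}^{\pm})$. The reference wave $E_{\mathrm{r}}$ and the carrier signal $f_{\mathrm{c}}$ are real-valued functions of time $t$. Put $T_1 := 2\pi/\omega_{\mathrm{in}}$. Steady state: for a continuous $T_1$-periodic wave $E(t)$, $x_E(t)$ denotes the steady state solution, i.e. the (unique) $T_1$-periodic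 solution $\tilde{x}$ of $m\,\tilde{x}''(t)+\gamma\,\tilde{x}'(t)+k\,\tilde{x}(t) = q\,E(t)$. The steady state displacements corresponding to the two phases are $x_{\mathrm{ss}}^{\pm}(t) := x_{E}(t)$ with $E=E_{\mathrm{in}}^{\pm}-E_{\mathrm{r}}$, i.e. the steady state solutions of $m x''+\gamma x'+k x = q\,(E_{\mathrm{in}}^{\pm}-E_{\mathrm{r}})$. Steady-state performance index: $$J_{\mathrm{ss}}(E_{\mathrm{r}}, f_{\mathrm{c}}, \theta_{\mathrm{in}}^{+}, \theta_{\mathrm{in}}^{-}) := \left|\frac{I_1}{T_1}\int_0^{T_1}\bigl(x_{\mathrm{ss}}^{+}(t)+x_{\mathrm{ss}}^{-}(t)\bigr)\bigl(x_{\mathrm{ss}}^{+}(t)-x_{\mathrm{ss}}^{-}(t)\bigr)f_{\mathrm{c}}(t)\,dt\right|.$$ Coefficient: $$\tilde{A} := \frac{q\,A_{\mathrm{in}}}{\sqrt{(k-m\omega_{\mathrm{in}}^2)^2+(\gamma\omega_{\mathrm{in}})^2}}.$$ *)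

theory Defs
  imports "HOL-Analysis.Analysis"
begin

definition E_in :: "real \<Rightarrow> real \<Rightarrow> real \<Rightarrow> real \<Rightarrow> real" where
  "E_in A\<^sub>i\<^sub>n \<omega>\<^sub>i\<^sub>n \<theta> t = A\<^sub>i\<^sub>n * cos (\<omega>\<^sub>i\<^sub>n * t + \<theta>)"

definition period :: "real \<Rightarrow> real" where
  "period \<omega>\<^sub>i\<^sub>n = 2 * pi / \<omega>\<^sub>i\<^sub>n"

definition periodic_solution ::
    "real \<Rightarrow> real \<Rightarrow> real \<Rightarrow> real \<Rightarrow> real \<Rightarrow> (real \<Rightarrow> real) \<Rightarrow> (real \<Rightarrow> real) \<Rightarrow> bool" where
  "periodic_solution m \<gamma> k q T E x \<longleftrightarrow>
     (\<forall>t. x (t + T) = x t) \<and>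
     (\<exists>x' x''. \<forall>t. (x has_real_derivative x' t) (at t) \<and>
                (x' has_real_derivative x'' t) (at t) \<and>
                m * x'' t + \<gamma> * x' t + k * x t = q * E t)"

text \<open>The following description operator is meaningful because, for positive \<open>m\<close>, \<open>\<gamma>\<close>, \<open>k\<close>, \<open>T\<close>
  and continuous \<open>T\<close>-periodic \<open>E\<close>, the periodic solution exists and is unique.\<close>

definition steady_state ::
    "real \<Rightarrow> real \<Rightarrow> real \<Rightarrow> real \<Rightarrow> real \<Rightarrow> (real \<Rightarrow> real) \<Rightarrow> (real \<Rightarrow> real)" where
  "steady_state m \<gamma> k q T E = (THE x. periodic_solution m \<gamma> k q T E x)"

definition x_ss ::
    "real \<Rightarrow> real \<Rightarrow> real \<Rightarrow> real \<Rightarrow> real \<Rightarrow> real \<Rightarrow> (real \<Rightarrow> real) \<Rightarrow> real \<Rightarrow> real \<Rightarrow> real" where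
  "x_ss m \<gamma> k q A\<^sub>i\<^sub>n \<omega>\<^sub>i\<^sub>n E\<^sub>r \<theta> =
     steady_state m \<gamma> k q (period \<omega>\<^sub>i\<^sub>n) (\<lambda>t. E_in A\<^sub>i\<^sub>n \<omega>\<^sub>i\<^sub>n \<theta> t - E\<^sub>r t)"

definition J_ss ::
    "real \<Rightarrow> real \<Rightarrow> real \<Rightarrow> real \<Rightarrow> real \<Rightarrow> real \<Rightarrow> real \<Rightarrow>
     (real \<Rightarrow> real) \<Rightarrow> (real \<Rightarrow> real) \<Rightarrow> real \<Rightarrow> real \<Rightarrow> real" where
  "J_ss m \<gamma> k q A\<^sub>i\<^sub>n \<omega>\<^sub>i\<^sub>n I\<^sub>1 E\<^sub>r f\<^sub>c \<theta>\<^sub>p \<theta>\<^sub>m =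
     (let x\<^sub>p = x_ss m \<gamma> k q A\<^sub>i\<^sub>n \<omega>\<^sub>i\<^sub>n E\<^sub>r \<theta>\<^sub>p;
          x\<^sub>m = x_ss m \<gamma> k q A\<^sub>i\<^sub>n \<omega>\<^sub>i\<^sub>n E\<^sub>r \<theta>\<^sub>m;
          T\<^sub>1 = period \<omega>\<^sub>i\<^sub>n
      in \<bar>I\<^sub>1 / T\<^sub>1 * integral {0..T\<^sub>1} (\<lambda>t. (x\<^sub>p t + x\<^sub>m t) * (x\<^sub>p t - x\<^sub>m t) * f\<^sub>c t)\<bar>)"

definition A_tilde :: "real \<Rightarrow> real \<Rightarrow> real \<Rightarrow> real \<Rightarrow> real \<Rightarrow> real \<Rightarrow> real" where
  "A_tilde m \<gamma> k q A\<^sub>i\<^sub>n \<omega>\<^sub>i\<^sub>n =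
     q * A\<^sub>i\<^sub>n / sqrt ((k - m * \<omega>\<^sub>i\<^sub>n\<^sup>2)\<^sup>2 + (\<gamma> * \<omega>\<^sub>i\<^sub>n)\<^sup>2)"

end

theory Submission
  imports Defs
begin

text \<open>With this reference wave, \<open>E_in\<^sup>+ - E\<^sub>r = (1 + \<eta>) (E_in\<^sup>+ - E_in\<^sup>-)\<close> and
  \<open>E_in\<^sup>- - E\<^sub>r = \<eta> (E_in\<^sup>+ - E_in\<^sup>-)\<close>. By linearity the two steady states are the multiples
  \<open>1 + \<eta>\<close> and \<open>\<eta>\<close> of a single sinusoid \<open>y\<close>, so the integrand is \<open>(2 \<eta> + 1) y\<^sup>2\<close>, and the mean of
  \<open>y\<^sup>2\<close> is half its squared amplitude. Uniqueness of the periodic solution comes from the energy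
  \<open>m x'\<^sup>2 + k x\<^sup>2\<close> of a homogeneous solution: it decreases at rate \<open>2 \<gamma> x'\<^sup>2\<close> and is periodic,
  hence constant, which forces \<open>x' = 0\<close>.\<close>

text \<open>Any \<open>u\<close> can be moved to the right of any \<open>v\<close> by adding enough
  periods, and \<open>f\<close> does not change on the way. So monotonicity gives
  \<open>f u \<le> f v\<close> for every pair, in both orders.\<close>

lemma periodic_decreasing_imp_const:
  fixes f :: "real \<Rightarrow> real"
  assumes T: "T > 0" and per: "\<And>t. f (t + T) = f t" and dec: "\<And>s t. s \<le> t \<Longrightarrow> f t \<le> f s"
  shows "f s = f t"
proof -
  have shift: "f (u + real n * T) = f u" for u n
  proof (induction n)
    case (Suc n)
    then show ?case using per[of "u + real n * T"] by (simp add: algebra_simps)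
  qed simp
  have le: "f u \<le> f v" for u v
  proof -
    obtain n where "v - u < real n * T"
      using reals_Archimedean3[OF T] by blast
    then show ?thesis using dec[of v "u + real n * T"] shift[of u n] by simp
  qed
  show ?thesis using le[of s t] le[of t s] by simp
qed

lemma DERIV_periodic:
  fixes f f' :: "real \<Rightarrow> real"
  assumes "\<And>t. f (t + T) = f t" and "\<And>t. (f has_real_derivative f' t) (at t)"
  shows "f' (t + T) = f' t"
proof -
  have "((\<lambda>t. f (t + T)) has_real_derivative f' (t + T)) (at t)"
    using assms(2)[of "t + T"] by (simp add: DERIV_shift)
  then have "(f has_real_derivative f' (t + T)) (at t)" by (simp add: assms(1))
  then show ?thesis using assms(2) by (rule DERIV_unique)
qed

lemma periodic_homogeneous_solution_eq_0:
  assumes pos: "\<gamma> > 0" "k > 0" "T > 0"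
    and sol: "periodic_solution m \<gamma> k q T (\<lambda>_. 0) x"
  shows "x t = 0"
proof -
  obtain x' x'' where d1: "\<And>t. (x has_real_derivative x' t) (at t)"
    and d2: "\<And>t. (x' has_real_derivative x'' t) (at t)"
    and ode: "\<And>t. m * x'' t + \<gamma> * x' t + k * x t = 0"
    and per: "\<And>t. x (t + T) = x t"
    using sol unfolding periodic_solution_def by auto
  \<comment> \<open>The energy contains the velocity as well, so its periodicity needs that of
    \<open>x'\<close>.\<close>
  have per': "x' (t + T) = x' t" for t
    by (rule DERIV_periodic[OF per d1])
  define V where "V t = m * (x' t)\<^sup>2 + k * (x t)\<^sup>2" for t
  have dV: "(V has_real_derivative (- 2 * \<gamma> * (x' t)\<^sup>2)) (at t)" for t
  proof -
    have "(V has_real_derivative (m * (2 * x' t * x'' t) + k * (2 * x t * x' t))) (at t)"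
      unfolding V_def by (auto intro!: derivative_eq_intros d1 d2)
    \<comment> \<open>The equation multiplied by \<open>2 * x' t\<close> removes the acceleration
      and leaves only the friction term.\<close>
    moreover have "m * (2 * x' t * x'' t) + k * (2 * x t * x' t)
        = 2 * x' t * (m * x'' t + \<gamma> * x' t + k * x t) - 2 * \<gamma> * (x' t)\<^sup>2"
      by (simp add: algebra_simps power2_eq_square)
    ultimately show ?thesis by (simp add: ode)
  qed
  have dec: "V t \<le> V s" if "s \<le> t" for s t
    using that pos by (intro DERIV_nonpos_imp_nonincreasing[of s t V]) (auto intro!: exI dV)
  have "V s = V t" for s t
    by (rule periodic_decreasing_imp_const[OF pos(3) _ dec]) (auto simp: V_def per per')
  then have "V = (\<lambda>_. V 0)" by auto
  then have "(V has_real_derivative 0) (at t)" for t by (metis DERIV_const)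
  then have "x' t = 0" for t using DERIV_unique[OF dV] pos by force
  then have x'0: "x' = (\<lambda>_. 0)" by auto
  \<comment> \<open>With velocity and acceleration both zero, the equation reduces to
    \<open>k * x t = 0\<close>.\<close>
  then have "x'' t = 0" using DERIV_unique[OF d2[of t]] DERIV_const by metis
  then show ?thesis using ode[of t] x'0 pos by simp
qed

lemma periodic_solution_diff:
  assumes "periodic_solution m \<gamma> k q T E x" and "periodic_solution m \<gamma> k q T E y"
  shows "periodic_solution m \<gamma> k q T (\<lambda>_. 0) (\<lambda>t. x t - y t)"
proof -
  obtain x' x'' where x: "\<And>t. (x has_real_derivative x' t) (at t)"
     "\<And>t. (x' has_real_derivative x'' t) (at t)"
     "\<And>t. m * x'' t + \<gamma> * x' t + k * x t = q * E t" "\<And>t. x (t + T) = x t"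
    using assms(1) unfolding periodic_solution_def by auto
  obtain y' y'' where y: "\<And>t. (y has_real_derivative y' t) (at t)"
     "\<And>t. (y' has_real_derivative y'' t) (at t)"
     "\<And>t. m * y'' t + \<gamma> * y' t + k * y t = q * E t" "\<And>t. y (t + T) = y t"
    using assms(2) unfolding periodic_solution_def by auto
  have "m * (x'' t - y'' t) + \<gamma> * (x' t - y' t) + k * (x t - y t) = 0" for t
    using x(3)[of t] y(3)[of t] by (simp add: algebra_simps)
  then show ?thesis
    unfolding periodic_solution_def
    by (intro conjI allI exI[of _ "\<lambda>t. x' t - y' t"] exI[of _ "\<lambda>t. x'' t - y'' t"])
       (auto intro!: derivative_intros x y simp: x(4) y(4))
qed

lemma steady_state_eqI:
  assumes "\<gamma> > 0" "k > 0" "T > 0" and sol: "periodic_solution m \<gamma> k q T E x"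
  shows "steady_state m \<gamma> k q T E = x"
  unfolding steady_state_def
proof (rule the_equality, rule sol)
  fix y assume "periodic_solution m \<gamma> k q T E y"
  from periodic_homogeneous_solution_eq_0[OF assms(1-3) periodic_solution_diff[OF this sol]]
  show "y = x" by (simp add: fun_eq_iff)
qed

text \<open>Undetermined coefficients: inserting \<open>P * cos + Q * sin\<close> gives the linear
  system \<open>a * P + b * Q = q * B\<close>, \<open>a * Q - b * P = q * C\<close>. Its determinant
  \<open>a\<^sup>2 + b\<^sup>2\<close> is nonzero because damping makes \<open>b\<close> positive.
  In complex terms, the amplitude \<open>B - i C\<close> of the force is multiplied by
  \<open>q / (a + i b)\<close>.\<close>

lemma steady_state_sinusoid:
  fixes m \<gamma> k q \<omega> B C :: real
  defines "a \<equiv> k - m * \<omega>\<^sup>2" and "b \<equiv> \<gamma> * \<omega>"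
  assumes pos: "\<gamma> > 0" "k > 0" "\<omega> > 0"
    and E: "\<And>t. E t = B * cos (\<omega> * t) + C * sin (\<omega> * t)"
  shows "steady_state m \<gamma> k q (period \<omega>) E =
    (\<lambda>t. q / (a\<^sup>2 + b\<^sup>2) * ((a * B - b * C) * cos (\<omega> * t) + (b * B + a * C) * sin (\<omega> * t)))"
    (is "_ = (\<lambda>t. ?K * (?P * cos _ + ?Q * sin _))")
proof (rule steady_state_eqI[OF pos(1,2)])
  have D: "a\<^sup>2 + b\<^sup>2 \<noteq> 0" using pos by (simp add: b_def)
  show "period \<omega> > 0" using pos by (simp add: period_def)
  have shift: "\<omega> * (t + period \<omega>) = \<omega> * t + 2 * pi" for t
    using pos by (simp add: period_def algebra_simps)
  have eq: "m * (- \<omega>\<^sup>2 * (?K * (?P * cos (\<omega> * t) + ?Q * sin (\<omega> * t))))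
      + \<gamma> * (?K * \<omega> * (?Q * cos (\<omega> * t) - ?P * sin (\<omega> * t)))
      + k * (?K * (?P * cos (\<omega> * t) + ?Q * sin (\<omega> * t))) = q * E t" for t
  proof -
    have "m * (- \<omega>\<^sup>2 * (?K * (?P * cos (\<omega> * t) + ?Q * sin (\<omega> * t))))
      + \<gamma> * (?K * \<omega> * (?Q * cos (\<omega> * t) - ?P * sin (\<omega> * t)))
      + k * (?K * (?P * cos (\<omega> * t) + ?Q * sin (\<omega> * t)))
      = ?K * (a * (?P * cos (\<omega> * t) + ?Q * sin (\<omega> * t))
        + b * (?Q * cos (\<omega> * t) - ?P * sin (\<omega> * t)))"
      unfolding a_def b_def by (simp only: algebra_simps)
    also have "\<dots> = ?K * ((a\<^sup>2 + b\<^sup>2) * E t)"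
      unfolding E by (simp add: algebra_simps power2_eq_square)
    also have "\<dots> = (?K * (a\<^sup>2 + b\<^sup>2)) * E t" by (simp only: mult.assoc)
    also have "?K * (a\<^sup>2 + b\<^sup>2) = q" 
      by (rule nonzero_divide_eq_eq[OF D, THEN iffD1, OF refl, symmetric])
    finally show ?thesis .
  qed
  show "periodic_solution m \<gamma> k q (period \<omega>) E
      (\<lambda>t. ?K * (?P * cos (\<omega> * t) + ?Q * sin (\<omega> * t)))"
    unfolding periodic_solution_def
  proof (intro conjI allI exI)
    fix t
    show "((\<lambda>t. ?K * (?P * cos (\<omega> * t) + ?Q * sin (\<omega> * t))) has_real_derivative
        ?K * \<omega> * (?Q * cos (\<omega> * t) - ?P * sin (\<omega> * t))) (at t)"
      by (rule derivative_eq_intros refl | simp add: algebra_simps)+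
    show "((\<lambda>t. ?K * \<omega> * (?Q * cos (\<omega> * t) - ?P * sin (\<omega> * t))) has_real_derivative
        - \<omega>\<^sup>2 * (?K * (?P * cos (\<omega> * t) + ?Q * sin (\<omega> * t)))) (at t)"
      by (rule derivative_eq_intros refl | simp add: algebra_simps power2_eq_square)+
  qed (simp add: shift, rule eq)
qed

lemma integral_sinusoid_square:
  assumes "\<omega> > 0"
  shows "((\<lambda>t. (P * cos (\<omega> * t) + Q * sin (\<omega> * t))\<^sup>2) has_integral
    (P\<^sup>2 + Q\<^sup>2) / 2 * period \<omega>) {0..period \<omega>}"
proof -
  \<comment> \<open>An antiderivative, from splitting
    \<open>P\<^sup>2 cos\<^sup>2 + Q\<^sup>2 sin\<^sup>2\<close> into its mean
    \<open>(P\<^sup>2 + Q\<^sup>2) / 2\<close> and a multiple of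
    \<open>cos\<^sup>2 - sin\<^sup>2\<close>, which is the derivative of \<open>sin * cos\<close> up
    to the factor \<omega>. The cross term integrates to a multiple of \<open>sin\<^sup>2\<close>.
    Both oscillating terms contain a sine that vanishes at the two endpoints.\<close>
  define F where "F t = (P\<^sup>2 + Q\<^sup>2) / 2 * t
    + (P\<^sup>2 - Q\<^sup>2) / (2 * \<omega>) * (sin (\<omega> * t) * cos (\<omega> * t)) + P * Q / \<omega> * (sin (\<omega> * t))\<^sup>2" for t
  have "(F has_real_derivative (P * cos (\<omega> * t) + Q * sin (\<omega> * t))\<^sup>2) (at t)" for t
  proof -
    have "(F has_real_derivative (P\<^sup>2 + Q\<^sup>2) / 2
        + (P\<^sup>2 - Q\<^sup>2) / (2 * \<omega>) * (\<omega> * ((cos (\<omega> * t))\<^sup>2 - (sin (\<omega> * t))\<^sup>2))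
        + P * Q / \<omega> * (2 * \<omega> * sin (\<omega> * t) * cos (\<omega> * t))) (at t)"
      unfolding F_def
      by (rule derivative_eq_intros refl | simp add: algebra_simps power2_eq_square)+
    also have "(P\<^sup>2 + Q\<^sup>2) / 2
        + (P\<^sup>2 - Q\<^sup>2) / (2 * \<omega>) * (\<omega> * ((cos (\<omega> * t))\<^sup>2 - (sin (\<omega> * t))\<^sup>2))
        + P * Q / \<omega> * (2 * \<omega> * sin (\<omega> * t) * cos (\<omega> * t))
      = (P * cos (\<omega> * t) + Q * sin (\<omega> * t))\<^sup>2"
      using assms by (simp add: cos_squared_eq power2_sum power_mult_distrib field_simps)
    finally show ?thesis .
  qed
  then have "((\<lambda>t. (P * cos (\<omega> * t) + Q * sin (\<omega> * t))\<^sup>2) has_integral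
      (F (period \<omega>) - F 0)) {0..period \<omega>}"
    using assms
    by (intro fundamental_theorem_of_calculus)
       (auto simp: period_def simp flip: has_real_derivative_iff_has_vector_derivative
             intro: has_field_derivative_at_within)
  moreover have "F (period \<omega>) - F 0 = (P\<^sup>2 + Q\<^sup>2) / 2 * period \<omega>"
    using assms by (simp add: F_def period_def)
  ultimately show ?thesis by simp
qed

theorem theorem1:
  fixes m \<gamma> k q A\<^sub>i\<^sub>n \<omega>\<^sub>i\<^sub>n I\<^sub>1 \<eta> \<theta>\<^sub>p \<theta>\<^sub>m :: real
    and E\<^sub>r f\<^sub>c :: "real \<Rightarrow> real"
  assumes "m > 0" and "\<gamma> > 0" and "k > 0" and "\<omega>\<^sub>i\<^sub>n > 0"
    and "\<And>t. f\<^sub>c t = 1"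
    and "\<And>t. E\<^sub>r t = - \<eta> * E_in A\<^sub>i\<^sub>n \<omega>\<^sub>i\<^sub>n \<theta>\<^sub>p t + (1 + \<eta>) * E_in A\<^sub>i\<^sub>n \<omega>\<^sub>i\<^sub>n \<theta>\<^sub>m t"
  shows "J_ss m \<gamma> k q A\<^sub>i\<^sub>n \<omega>\<^sub>i\<^sub>n I\<^sub>1 E\<^sub>r f\<^sub>c \<theta>\<^sub>p \<theta>\<^sub>m =
    \<bar>I\<^sub>1 * (A_tilde m \<gamma> k q A\<^sub>i\<^sub>n \<omega>\<^sub>i\<^sub>n)\<^sup>2 * (2 * \<eta> + 1)\<bar> * (1 - cos (\<theta>\<^sub>m - \<theta>\<^sub>p))"
proof -
  define a where "a = k - m * \<omega>\<^sub>i\<^sub>n\<^sup>2"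
  define b where "b = \<gamma> * \<omega>\<^sub>i\<^sub>n"
  define D where "D = a\<^sup>2 + b\<^sup>2"
  \<comment> \<open>\<open>B\<close> and \<open>C\<close> are the cosine and sine coefficients of
    the difference of the two incoming waves, by the addition formula; \<open>P\<close> and
    \<open>Q\<close> are those of its response \<open>y\<close>.\<close>
  define B where "B = A\<^sub>i\<^sub>n * (cos \<theta>\<^sub>p - cos \<theta>\<^sub>m)"
  define C where "C = - A\<^sub>i\<^sub>n * (sin \<theta>\<^sub>p - sin \<theta>\<^sub>m)"
  define P where "P = q / D * (a * B - b * C)"
  define Q where "Q = q / D * (b * B + a * C)"
  define y where "y t = P * cos (\<omega>\<^sub>i\<^sub>n * t) + Q * sin (\<omega>\<^sub>i\<^sub>n * t)" for t
  let ?T = "period \<omega>\<^sub>i\<^sub>n"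
  have D: "D > 0" using assms by (simp add: D_def b_def add_nonneg_pos)
  have T: "?T > 0" using assms by (simp add: period_def)
  have response: "steady_state m \<gamma> k q ?T E = (\<lambda>t. c * y t)"
    if "\<And>t. E t = c * (E_in A\<^sub>i\<^sub>n \<omega>\<^sub>i\<^sub>n \<theta>\<^sub>p t - E_in A\<^sub>i\<^sub>n \<omega>\<^sub>i\<^sub>n \<theta>\<^sub>m t)" for c E
  proof -
    have E: "E t = c * B * cos (\<omega>\<^sub>i\<^sub>n * t) + c * C * sin (\<omega>\<^sub>i\<^sub>n * t)" for t
      by (simp add: that E_in_def B_def C_def cos_add algebra_simps)
    have "steady_state m \<gamma> k q ?T E = (\<lambda>t. q / D * ((a * (c * B) - b * (c * C)) * cos (\<omega>\<^sub>i\<^sub>n * t)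
        + (b * (c * B) + a * (c * C)) * sin (\<omega>\<^sub>i\<^sub>n * t)))"
      unfolding D_def a_def b_def by (rule steady_state_sinusoid[OF assms(2-4) E])
    then show ?thesis by (simp add: y_def P_def Q_def algebra_simps)
  qed
  have xp: "x_ss m \<gamma> k q A\<^sub>i\<^sub>n \<omega>\<^sub>i\<^sub>n E\<^sub>r \<theta>\<^sub>p = (\<lambda>t. (1 + \<eta>) * y t)"
    unfolding x_ss_def by (rule response) (simp add: assms(6) algebra_simps)
  have xm: "x_ss m \<gamma> k q A\<^sub>i\<^sub>n \<omega>\<^sub>i\<^sub>n E\<^sub>r \<theta>\<^sub>m = (\<lambda>t. \<eta> * y t)"
    unfolding x_ss_def by (rule response) (simp add: assms(6) algebra_simps)
  have "((\<lambda>t. (2 * \<eta> + 1) * (y t)\<^sup>2) has_integral (2 * \<eta> + 1) * ((P\<^sup>2 + Q\<^sup>2) / 2 * ?T)) {0..?T}"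
    unfolding y_def by (intro has_integral_mult_right integral_sinusoid_square assms)
  \<comment> \<open>The two responses have sum \<open>(2 * \<eta> + 1) * y t\<close> and difference
    \<open>y t\<close>.\<close>
  moreover have "((1 + \<eta>) * y t + \<eta> * y t) * ((1 + \<eta>) * y t - \<eta> * y t) * f\<^sub>c t
      = (2 * \<eta> + 1) * (y t)\<^sup>2" for t
    by (simp add: assms(5) algebra_simps power2_eq_square)
  ultimately have J: "J_ss m \<gamma> k q A\<^sub>i\<^sub>n \<omega>\<^sub>i\<^sub>n I\<^sub>1 E\<^sub>r f\<^sub>c \<theta>\<^sub>p \<theta>\<^sub>m
      = \<bar>I\<^sub>1 / ?T * ((2 * \<eta> + 1) * ((P\<^sup>2 + Q\<^sup>2) / 2 * ?T))\<bar>"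
    unfolding J_ss_def Let_def xp xm by (simp only: integral_unique)
  have "P\<^sup>2 + Q\<^sup>2 = (q / D)\<^sup>2 * ((a * B - b * C)\<^sup>2 + (b * B + a * C)\<^sup>2)"
    unfolding P_def Q_def power_mult_distrib by (simp only: distrib_left)
  \<comment> \<open>Multiplicativity of the squared modulus for
    \<open>(a + i b) (B + i C)\<close>.\<close>
  also have "(a * B - b * C)\<^sup>2 + (b * B + a * C)\<^sup>2 = D * (B\<^sup>2 + C\<^sup>2)"
    by (simp add: D_def algebra_simps power2_eq_square)
  also have "(q / D)\<^sup>2 * (D * (B\<^sup>2 + C\<^sup>2)) = q\<^sup>2 / D * (B\<^sup>2 + C\<^sup>2)"
    using D by (simp add: power_divide power2_eq_square)
  \<comment> \<open>Up to the factor \<open>A\<^sub>i\<^sub>n\<^sup>2\<close>, this is the squared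
    chord between the points of the unit circle at angles \<open>\<theta>\<^sub>p\<close> and
    \<open>\<theta>\<^sub>m\<close>. The 2 cancels against the 1/2 from the mean of a squared
    sinusoid.\<close>
  also have "B\<^sup>2 + C\<^sup>2 = A\<^sub>i\<^sub>n\<^sup>2 * (2 * (1 - cos (\<theta>\<^sub>m - \<theta>\<^sub>p)))"
  proof -
    have "B\<^sup>2 + C\<^sup>2 = A\<^sub>i\<^sub>n\<^sup>2 * (((cos \<theta>\<^sub>p)\<^sup>2 + (sin \<theta>\<^sub>p)\<^sup>2) + ((cos \<theta>\<^sub>m)\<^sup>2 + (sin \<theta>\<^sub>m)\<^sup>2)
        - 2 * cos (\<theta>\<^sub>m - \<theta>\<^sub>p))"
      unfolding B_def C_def cos_diff by algebra
    then show ?thesis by simp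
  qed
  also have "q\<^sup>2 / D * (A\<^sub>i\<^sub>n\<^sup>2 * (2 * (1 - cos (\<theta>\<^sub>m - \<theta>\<^sub>p))))
      = 2 * ((A_tilde m \<gamma> k q A\<^sub>i\<^sub>n \<omega>\<^sub>i\<^sub>n)\<^sup>2 * (1 - cos (\<theta>\<^sub>m - \<theta>\<^sub>p)))"
  proof -
    have "(A_tilde m \<gamma> k q A\<^sub>i\<^sub>n \<omega>\<^sub>i\<^sub>n)\<^sup>2 = (q * A\<^sub>i\<^sub>n)\<^sup>2 / D"
      using D by (simp add: A_tilde_def power_divide D_def a_def b_def)
    then show ?thesis by (simp add: power_mult_distrib)
  qed
  finally have amp: "(P\<^sup>2 + Q\<^sup>2) / 2 = (A_tilde m \<gamma> k q A\<^sub>i\<^sub>n \<omega>\<^sub>i\<^sub>n)\<^sup>2 * (1 - cos (\<theta>\<^sub>m - \<theta>\<^sub>p))"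
    by simp
  have "I\<^sub>1 / ?T * ((2 * \<eta> + 1) * ((P\<^sup>2 + Q\<^sup>2) / 2 * ?T))
      = I\<^sub>1 * (A_tilde m \<gamma> k q A\<^sub>i\<^sub>n \<omega>\<^sub>i\<^sub>n)\<^sup>2 * (2 * \<eta> + 1) * (1 - cos (\<theta>\<^sub>m - \<theta>\<^sub>p))"
    unfolding amp using T by simp
  \<comment> \<open>This factor is nonnegative, so it leaves the absolute value unchanged.\<close>
  moreover have "\<bar>1 - cos (\<theta>\<^sub>m - \<theta>\<^sub>p)\<bar> = 1 - cos (\<theta>\<^sub>m - \<theta>\<^sub>p)"
    by simp
  ultimately show ?thesis unfolding J by (simp only: abs_mult)
qed

end
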